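(* For every integer $n\ge 1$, $$\mu(\operatorname{Rees}(\mathscr{C}_n,C_{n+1}))=(-1)^n\cdot\sum_{c}2^{n-c_1}\binom{n}{c_1,\dots,c_k}\cdot c_1\cdot\prod_{i=2}^{k}(c_i-1),$$ where the sum is over all compositions $c=(c_1,\dots,c_k)$ of $n$ (ordered sequences of positive integers with sum $n$), for all $k$ with $1\le k\le n$.
   Context: $\mu(P)$ denotes the Möbius function value $\mu_P(\hat 0,\hat 1)$ of a finite poset $P$ with minimum $\hat 0$ and maximum $\hat 1$. $\mathscr{C}_n$ is the cubical lattice: the face lattice of the $n$-dimensional cube (including the empty face $\hat 0$), of rank $n+1$. $C_{n+1}$ is the chain on $n+1$ elements. Rees product: for posets $P,Q$ with rank functions $\rho$ (minimal elements having rank $0$), $P*Q$ is the set of pairs $(p,q)\in P\times Q$ with $\rho(p)\ge\rho(q)$, ordered by $(p,q)\le(p',q')$ iff $p\le_P p'$, $q\le_Q q'$ and $\rho(p')-\rho(p)\ge\rho(q')-\rho(q)$. For $P$ graded with minimum $\hat 0$ and maximum $\hat 1$, $\operatorname{Rees}(P,Q)=((P-\{\hat 0\})*Q)\cup\{\hat 0,\hat 1\}$, where a new minimum $\hat 0$ and a new maximum $\hat 1$ are adjoined, and where in $P-\{\hat 0\}$ the atoms of $P$ have rank $0$. *)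

theory Defs
  imports "HOL-Analysis.Analysis"
begin

text \<open>A poset is given by its reflexive order relation \<open>r\<close>; the underlying set is \<open>Field r\<close>.\<close>

definition least_elem :: "'a rel \<Rightarrow> 'a" where
  "least_elem r = (THE x. x \<in> Field r \<and> (\<forall>y\<in>Field r. (x, y) \<in> r))"

definition greatest_elem :: "'a rel \<Rightarrow> 'a" where
  "greatest_elem r = (THE x. x \<in> Field r \<and> (\<forall>y\<in>Field r. (y, x) \<in> r))"

text \<open>The guard makes the recursion well-founded; it holds for every finite poset.\<close>

function moebius :: "'a rel \<Rightarrow> 'a \<Rightarrow> 'a \<Rightarrow> int" where
  "moebius r x y =
     (if finite r \<and> Partial_order r \<and> (x, y) \<in> r
      then if x = y then 1
           else - (\<Sum>z\<in>{z. (x, z) \<in> r \<and> (z, y) \<in> r \<and> z \<noteq> y}. moebius r x z)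
      else 0)"
  by pat_completeness auto
termination
proof (relation "Wellfounded.measure (\<lambda>(r, x, y). card {z. (x, z) \<in> r \<and> (z, y) \<in> r})", goal_cases)
  case 1
  show ?case by simp
next
  case (2 r x y z)
  then have po: "finite r" "trans r" "antisym r" "refl_on (Field r) r"
    and xy: "(x, y) \<in> r" and z: "(x, z) \<in> r" "(z, y) \<in> r" "z \<noteq> y"
    by (auto simp: partial_order_on_def preorder_on_def)
  have "{w. (x, w) \<in> r \<and> (w, z) \<in> r} \<subset> {w. (x, w) \<in> r \<and> (w, y) \<in> r}"
  proof
    show "{w. (x, w) \<in> r \<and> (w, z) \<in> r} \<subseteq> {w. (x, w) \<in> r \<and> (w, y) \<in> r}"
      using po(2) z(2) by (auto dest: transD)
    have "(y, y) \<in> r"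
      using po(4) xy by (auto simp: refl_on_def Field_def)
    moreover have "(y, z) \<notin> r"
      using po(3) z by (auto dest: antisymD)
    ultimately show "{w. (x, w) \<in> r \<and> (w, z) \<in> r} \<noteq> {w. (x, w) \<in> r \<and> (w, y) \<in> r}"
      using xy by blast
  qed
  moreover have "finite {w. (x, w) \<in> r \<and> (w, y) \<in> r}"
    by (rule finite_subset[of _ "snd ` r"]) (use po(1) in \<open>force+\<close>)
  ultimately show ?case
    by (simp add: psubset_card_mono)
qed

declare moebius.simps [simp del]

definition moebius_number :: "'a rel \<Rightarrow> int" where
  "moebius_number r = moebius r (least_elem r) (greatest_elem r)"

definition covered_by :: "'a rel \<Rightarrow> 'a \<Rightarrow> 'a \<Rightarrow> bool" where
  "covered_by r x y \<longleftrightarrow>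
     (x, y) \<in> r \<and> x \<noteq> y \<and> (\<forall>z. (x, z) \<in> r \<and> (z, y) \<in> r \<longrightarrow> z = x \<or> z = y)"

definition rank_function :: "'a rel \<Rightarrow> ('a \<Rightarrow> nat) \<Rightarrow> bool" where
  "rank_function r \<rho> \<longleftrightarrow>
     (\<forall>x\<in>Field r. (\<forall>y. (y, x) \<in> r \<longrightarrow> y = x) \<longrightarrow> \<rho> x = 0) \<and>
     (\<forall>x y. covered_by r x y \<longrightarrow> \<rho> y = \<rho> x + 1)"

text \<open>On a finite poset a rank function is unique on \<open>Field r\<close> if it exists; the choice below is
  only applied to elements of \<open>Field r\<close>.\<close>

definition poset_rank :: "'a rel \<Rightarrow> 'a \<Rightarrow> nat" where
  "poset_rank r = (SOME \<rho>. rank_function r \<rho>)"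

text \<open>The inequality between differences of ranks is taken over the integers.\<close>

definition rees_product :: "'a rel \<Rightarrow> 'b rel \<Rightarrow> ('a \<times> 'b) rel" where
  "rees_product r s =
     {((p, q), (p', q')).
        poset_rank s q \<le> poset_rank r p \<and> poset_rank s q' \<le> poset_rank r p' \<and>
        (p, p') \<in> r \<and> (q, q') \<in> s \<and>
        int (poset_rank r p') - int (poset_rank r p) \<ge> int (poset_rank s q') - int (poset_rank s q)}"

datatype 'a bounded_ext = Bottom | Elem 'a | Top

definition adjoin_bounds :: "'a rel \<Rightarrow> 'a bounded_ext rel" where
  "adjoin_bounds r =
     (let A = {Bottom, Top} \<union> Elem ` Field r
      in {(Bottom, x) |x. x \<in> A} \<union> {(x, Top) |x. x \<in> A} \<union> {(Elem x, Elem y) |x y. (x, y) \<in> r})"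

definition remove_least :: "'a rel \<Rightarrow> 'a rel" where
  "remove_least r = Restr r (Field r - {least_elem r})"

definition Rees :: "'a rel \<Rightarrow> 'b rel \<Rightarrow> ('a \<times> 'b) bounded_ext rel" where
  "Rees r s = adjoin_bounds (rees_product (remove_least r) s)"

text \<open>The cube is \<open>[0,1]\<^sup>n\<close> in \<open>\<real>\<^sup>n\<close> with \<open>n = CARD('n)\<close>; the empty set is a face in the sense of
  \<open>face_of\<close>.\<close>

definition cubical_lattice :: "(real ^ 'n) set rel" where
  "cubical_lattice = {(F, G). F face_of cbox 0 1 \<and> G face_of cbox 0 1 \<and> F \<subseteq> G}"

definition chain_poset :: "nat \<Rightarrow> nat rel" where
  "chain_poset m = {(i, j). i \<le> j \<and> j < m}"

definition compositions :: "nat \<Rightarrow> nat list set" where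
  "compositions n = {c. (\<forall>i\<in>set c. i \<ge> 1) \<and> sum_list c = n}"

definition multinomial :: "nat list \<Rightarrow> nat" where
  "multinomial c = fact (sum_list c) div prod_list (map fact c)"

end

theory Submission
  imports Defs "HOL-Computational_Algebra.Formal_Power_Series"
begin

text \<open>
  Call the sum of the Moebius values of the Rees product over all pairs with the same first
  component \<open>F\<close> the fibre sum at \<open>F\<close>. Adding up the Moebius recursion over one fibre
  eliminates the chain: a fibre element over \<open>G \<subseteq> F\<close> lies below exactly
  \<open>dim F - dim G + 1\<close> elements of the fibre over \<open>F\<close>, so the fibre sums \<open>S\<close> satisfy
  \<open>\<Sum>G\<subseteq>F. (dim F - dim G + 1) S(G) = - (dim F + 1)\<close>, and the Moebius number is minus \<open>1 + \<Sum>F. S(F)\<close>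
  (\<open>moebius_number_rees_product_chain\<close>). The same holds for any finite poset with a rank
  function in place of the face poset, if the chain has more elements than the largest rank.

  For the cube, the nonempty faces correspond to intervals \<open>L \<subseteq> U\<close> of subsets of the coordinates
  (\<open>face_of_cube_iff\<close>), and a \<open>k\<close>-face contains \<open>(k choose i) 2\<^bsup>k-i\<^esup>\<close> faces of dimension \<open>i\<close>
  (\<open>sum_subfaces\<close>). Hence \<open>S\<close> depends only on the dimension, and its exponential generating
  function is \<open>- (1 + x) e\<^bsup>-x\<^esup> / (1 + 2 x)\<close> (\<open>face_weight_recurrence\<close>). That of the Moebius
  numbers is therefore \<open>- x e\<^sup>x / (1 + 2 x)\<close>.

  On the other side, weights that are multiplicative over the parts of a composition sum to a
  geometric series, which yields \<open>x e\<^bsup>-x\<^esup> / (1 - 2 x)\<close> for the composition sums without the sign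
  (\<open>egf_composition_sum\<close>). The two series agree after \<open>x \<mapsto> -x\<close> (\<open>face_weight_total\<close>).
\<close>

section \<open>Moebius numbers of bounded extensions\<close>

lemma sum_moebius_interval:
  assumes "finite r" "Partial_order r" "(x, y) \<in> r" "x \<noteq> y"
  shows "(\<Sum>z | (x, z) \<in> r \<and> (z, y) \<in> r. moebius r x z) = 0"
proof -
  have "(y, y) \<in> r"
    using assms by (auto simp: partial_order_on_def preorder_on_def refl_on_def Field_def)
  then have eq: "{z. (x, z) \<in> r \<and> (z, y) \<in> r} = insert y {z. (x, z) \<in> r \<and> (z, y) \<in> r \<and> z \<noteq> y}"
    using assms by auto
  have fin: "finite {z. (x, z) \<in> r \<and> (z, y) \<in> r \<and> z \<noteq> y}"
    by (rule finite_subset[of _ "snd ` r"]) (use assms(1) in \<open>force+\<close>)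
  show ?thesis
    unfolding eq using fin assms by (simp add: moebius.simps[of r x y])
qed

lemma in_adjoin_bounds_simps [simp]:
  "(Bottom, x) \<in> adjoin_bounds r \<longleftrightarrow> x \<in> {Bottom, Top} \<union> Elem ` Field r"
  "(x, Top) \<in> adjoin_bounds r \<longleftrightarrow> x \<in> {Bottom, Top} \<union> Elem ` Field r"
  "(Elem a, Elem b) \<in> adjoin_bounds r \<longleftrightarrow> (a, b) \<in> r"
  "(Elem a, Bottom) \<notin> adjoin_bounds r"
  "(Top, Bottom) \<notin> adjoin_bounds r"
  "(Top, Elem b) \<notin> adjoin_bounds r"
  by (auto simp: adjoin_bounds_def Let_def)

lemma Field_adjoin_bounds: "Field (adjoin_bounds r) = {Bottom, Top} \<union> Elem ` Field r"
proof
  show "Field (adjoin_bounds r) \<subseteq> {Bottom, Top} \<union> Elem ` Field r"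
    by (auto simp: adjoin_bounds_def Let_def Field_def)
  have "x \<in> Field (adjoin_bounds r)" if "(Bottom, x) \<in> adjoin_bounds r" for x
    using that by (rule FieldI2)
  then show "{Bottom, Top} \<union> Elem ` Field r \<subseteq> Field (adjoin_bounds r)"
    by (intro subsetI) simp
qed

lemma finite_adjoin_bounds:
  assumes "finite r"
  shows "finite (adjoin_bounds r)"
proof -
  have "adjoin_bounds r \<subseteq> Field (adjoin_bounds r) \<times> Field (adjoin_bounds r)"
    by (auto simp: Field_def)
  then show ?thesis
    using assms by (rule_tac finite_subset) (auto simp: Field_adjoin_bounds finite_Field)
qed

lemma Partial_order_adjoin_bounds:
  assumes "Partial_order r"
  shows "Partial_order (adjoin_bounds r)"
proof -
  have r: "refl_on (Field r) r" "trans r" "antisym r"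
    using assms by (auto simp: partial_order_on_def preorder_on_def)
  have "refl_on (Field (adjoin_bounds r)) (adjoin_bounds r)"
    using r(1) by (auto simp: refl_on_def Field_adjoin_bounds)
  moreover have "trans (adjoin_bounds r)"
  proof (rule transI)
    fix x y z assume xy: "(x, y) \<in> adjoin_bounds r" and yz: "(y, z) \<in> adjoin_bounds r"
    have "x \<in> Field (adjoin_bounds r)" "z \<in> Field (adjoin_bounds r)"
      using xy yz by (auto simp: Field_def)
    then show "(x, z) \<in> adjoin_bounds r"
      using xy yz r(2)
      by (cases x; cases y; cases z) (auto simp: Field_adjoin_bounds dest: transD)
  qed
  moreover have "antisym (adjoin_bounds r)"
  proof (rule antisymI)
    fix x y assume "(x, y) \<in> adjoin_bounds r" "(y, x) \<in> adjoin_bounds r"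
    then show "x = y"
      using r(3) by (cases x; cases y) (auto dest: antisymD)
  qed
  ultimately show ?thesis
    by (auto simp: partial_order_on_def preorder_on_def Field_def)
qed

lemma least_elem_eqI:
  assumes "antisym r" "x \<in> Field r" "\<And>y. y \<in> Field r \<Longrightarrow> (x, y) \<in> r"
  shows "least_elem r = x"
  unfolding least_elem_def using assms by (blast dest: antisymD)

lemma greatest_elem_eqI:
  assumes "antisym r" "x \<in> Field r" "\<And>y. y \<in> Field r \<Longrightarrow> (y, x) \<in> r"
  shows "greatest_elem r = x"
  unfolding greatest_elem_def using assms by (blast dest: antisymD)

text \<open>In the bounded extension the defining recursion of the Moebius function collapses: the
  values \<open>m\<close> at the proper elements sum to \<open>-1\<close> over each principal down-set, since the new
  minimum contributes \<open>1\<close>, and the value at the new maximum balances everything else.\<close>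

lemma moebius_adjoin_bounds:
  assumes "finite r" "Partial_order r"
  defines "m \<equiv> \<lambda>x. moebius (adjoin_bounds r) Bottom (Elem x)"
  shows "\<And>x. x \<in> Field r \<Longrightarrow> (\<Sum>y | (y, x) \<in> r. m y) = - 1"
    and "moebius_number (adjoin_bounds r) = - (1 + (\<Sum>x\<in>Field r. m x))"
proof -
  let ?R = "adjoin_bounds r"
  have R: "finite ?R" "Partial_order ?R"
    using assms finite_adjoin_bounds Partial_order_adjoin_bounds by auto
  have asym: "antisym ?R"
    using R(2) by (simp add: partial_order_on_def)
  have bot: "moebius ?R Bottom Bottom = 1"
    using R by (simp add: moebius.simps[of ?R])
  show "(\<Sum>y | (y, x) \<in> r. m y) = - 1" if x: "x \<in> Field r" for x
  proof -
    have fin: "finite {y. (y, x) \<in> r}"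
      by (rule finite_subset[of _ "fst ` r"]) (use assms(1) in \<open>force+\<close>)
    have "{z. (Bottom, z) \<in> ?R \<and> (z, Elem x) \<in> ?R} = insert Bottom (Elem ` {y. (y, x) \<in> r})"
    proof (rule set_eqI)
      fix z show "z \<in> {z. (Bottom, z) \<in> ?R \<and> (z, Elem x) \<in> ?R} \<longleftrightarrow>
          z \<in> insert Bottom (Elem ` {y. (y, x) \<in> r})"
        using x by (cases z) (auto simp: Field_def)
    qed
    then have "0 = (\<Sum>z\<in>insert Bottom (Elem ` {y. (y, x) \<in> r}). moebius ?R Bottom z)"
      using sum_moebius_interval[OF R, of Bottom "Elem x"] x by simp
    also have "\<dots> = 1 + (\<Sum>y | (y, x) \<in> r. m y)"
      using fin bot by (subst sum.insert) (auto simp: sum.reindex m_def inj_on_def)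
    finally show ?thesis by simp
  qed
  have "least_elem ?R = Bottom" "greatest_elem ?R = Top"
    by (auto intro!: least_elem_eqI greatest_elem_eqI asym simp: Field_adjoin_bounds)
  then have "moebius_number ?R = moebius ?R Bottom Top"
    by (simp add: moebius_number_def)
  moreover have "{z. (Bottom, z) \<in> ?R \<and> (z, Top) \<in> ?R} = insert Bottom (insert Top (Elem ` Field r))"
    by auto
  then have "0 = (\<Sum>z\<in>insert Bottom (insert Top (Elem ` Field r)). moebius ?R Bottom z)"
    using sum_moebius_interval[OF R, of Bottom Top] by simp
  then have "0 = 1 + moebius ?R Bottom Top + (\<Sum>x\<in>Field r. m x)"
    using finite_Field[OF assms(1)] bot
    by (subst (asm) sum.insert, simp, force, subst (asm) sum.insert)
       (auto simp: sum.reindex m_def inj_on_def)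
  ultimately show "moebius_number ?R = - (1 + (\<Sum>x\<in>Field r. m x))"
    by simp
qed

section \<open>Rank functions on finite posets\<close>

lemma finite_poset_induct [consumes 3, case_names less]:
  assumes "finite r" "Partial_order r" "x \<in> Field r"
    and step: "\<And>x. x \<in> Field r \<Longrightarrow> (\<And>y. (y, x) \<in> r \<Longrightarrow> y \<noteq> x \<Longrightarrow> P y) \<Longrightarrow> P x"
  shows "P x"
proof -
  have "acyclic (r - Id)"
    by (rule partial_order_on_acyclic[OF assms(2)])
  then have "wf (r - Id)"
    using assms(1) by (simp add: finite_acyclic_wf)
  then show ?thesis using assms(3)
  proof (induction x rule: wf_induct_rule)
    case (less x)
    show ?case
    proof (rule step)
      fix y assume y: "(y, x) \<in> r" "y \<noteq> x"
      show "P y"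
        by (rule less.IH) (use y in \<open>auto intro: FieldI1\<close>)
    qed (rule less.prems)
  qed
qed

lemma ex_covered_by:
  assumes "finite r" "Partial_order r" "(y, x) \<in> r" "y \<noteq> x"
  shows "\<exists>z. covered_by r z x"
proof -
  have "acyclic (r - Id)"
    by (rule partial_order_on_acyclic[OF assms(2)])
  then have "wf ((r - Id)\<inverse>)"
    using assms(1) by (intro finite_acyclic_wf) auto
  moreover have "y \<in> {z. (z, x) \<in> r - Id}"
    using assms by auto
  ultimately obtain z where z: "z \<in> {z. (z, x) \<in> r - Id}"
    "\<And>w. (w, z) \<in> (r - Id)\<inverse> \<Longrightarrow> w \<notin> {z. (z, x) \<in> r - Id}"
    by (metis (no_types, lifting) wfE_min)
  then have "covered_by r z x"
    unfolding covered_by_def by auto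
  then show ?thesis ..
qed

lemma rank_function_minimal:
  "rank_function r \<rho> \<Longrightarrow> x \<in> Field r \<Longrightarrow> (\<And>y. (y, x) \<in> r \<Longrightarrow> y = x) \<Longrightarrow> \<rho> x = 0"
  unfolding rank_function_def by blast

lemma rank_function_cover:
  "rank_function r \<rho> \<Longrightarrow> covered_by r x y \<Longrightarrow> \<rho> y = \<rho> x + 1"
  unfolding rank_function_def by blast

text \<open>Every non-minimal element of a finite poset covers something, so the two clauses of
  \<open>rank_function\<close> determine the rank by induction. This makes the choice in \<open>poset_rank\<close>
  harmless: any explicit rank function may be used in its place.\<close>

lemma poset_rank_eq:
  assumes "finite r" "Partial_order r" "rank_function r \<rho>" "x \<in> Field r"
  shows "poset_rank r x = \<rho> x"
proof -
  have rk: "rank_function r (poset_rank r)"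
    unfolding poset_rank_def using someI[of "rank_function r", OF assms(3)] .
  from assms(1,2,4) show ?thesis
  proof (induction x rule: finite_poset_induct)
    case (less x)
    show ?case
    proof (cases "\<forall>y. (y, x) \<in> r \<longrightarrow> y = x")
      case True
      then have "\<rho>' x = 0" if "rank_function r \<rho>'" for \<rho>'
        using that less.hyps by (blast intro: rank_function_minimal)
      then show ?thesis
        using rk assms(3) by metis
    next
      case False
      then obtain z where z: "covered_by r z x"
        using ex_covered_by[OF assms(1,2)] by blast
      then have "(z, x) \<in> r" "z \<noteq> x"
        by (auto simp: covered_by_def)
      then show ?thesis
        using rank_function_cover[OF rk z] rank_function_cover[OF assms(3) z] less.IH[of z] by simp
    qed
  qed
qed

lemma chain_poset_simps:
  "Field (chain_poset m) = {..<m}" "finite (chain_poset m)" "Partial_order (chain_poset m)"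
proof -
  show F: "Field (chain_poset m) = {..<m}"
    by (auto simp: Field_def chain_poset_def)
  show "finite (chain_poset m)"
    by (rule finite_subset[of _ "{..<m} \<times> {..<m}"]) (auto simp: chain_poset_def)
  show "Partial_order (chain_poset m)"
    unfolding partial_order_on_def preorder_on_def F
    by (auto simp: chain_poset_def refl_on_def trans_def antisym_def)
qed

lemma poset_rank_chain_poset:
  assumes "j < m"
  shows "poset_rank (chain_poset m) j = j"
proof -
  have "rank_function (chain_poset m) (\<lambda>j. j)"
    unfolding rank_function_def
  proof (intro conjI ballI allI impI)
    fix x assume "x \<in> Field (chain_poset m)" "\<forall>y. (y, x) \<in> chain_poset m \<longrightarrow> y = x"
    then have "(0, x) \<in> chain_poset m \<longrightarrow> 0 = x" "x < m"
      by (auto simp: chain_poset_simps(1))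
    then show "x = 0"
      by (simp add: chain_poset_def)
  next
    fix x y assume c: "covered_by (chain_poset m) x y"
    then have "x < y" "y < m"
      by (auto simp: covered_by_def chain_poset_def)
    moreover from this have "Suc x = x \<or> Suc x = y"
      using c unfolding covered_by_def chain_poset_def by (elim conjE allE[of _ "Suc x"]) simp
    ultimately show "y = x + 1"
      by simp
  qed
  then show ?thesis
    using assms by (intro poset_rank_eq chain_poset_simps(2,3)) (simp_all add: chain_poset_simps(1))
qed

text \<open>For \<open>x \<noteq> y\<close>, apply induction to an element covered by \<open>y\<close> that still lies above \<open>x\<close>; it exists
  because the elements above \<open>x\<close> again form a finite poset, with the same covers.\<close>

lemma rank_function_mono:
  assumes "finite r" "Partial_order r" "rank_function r \<rho>" "(x, y) \<in> r"
  shows "\<rho> x \<le> \<rho> y"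
proof -
  have r: "refl_on (Field r) r" "trans r" "antisym r"
    using assms by (auto simp: partial_order_on_def preorder_on_def)
  have "y \<in> Field r" using assms(4) by (auto simp: Field_def)
  with assms(1,2) show ?thesis using assms(4)
  proof (induction y rule: finite_poset_induct)
    case (less y)
    show ?case
    proof (cases "x = y")
      case False
      let ?r = "Restr r {z. (x, z) \<in> r}"
      have "Partial_order ?r" "finite ?r"
        using assms(1,2) by (auto intro: Partial_order_Restr)
      moreover have "(x, y) \<in> ?r" using less.prems r by (auto simp: refl_on_def Field_def)
      ultimately obtain z where z: "covered_by ?r z y"
        using ex_covered_by[of ?r x y] False by blast
      then have xz: "(x, z) \<in> r" and zy: "(z, y) \<in> r" "z \<noteq> y"
        by (auto simp: covered_by_def)
      have "covered_by r z y"
        unfolding covered_by_def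
      proof (intro conjI allI impI zy)
        fix w assume "(z, w) \<in> r \<and> (w, y) \<in> r"
        then show "w = z \<or> w = y"
          using z xz r(2) unfolding covered_by_def by (blast dest: transD)
      qed
      then show ?thesis
        using rank_function_cover[OF assms(3)] less.IH[OF zy xz] by fastforce
    qed auto
  qed
qed

section \<open>Rees products with a chain\<close>

text \<open>The chain is long enough that its length imposes no bound beyond \<open>i \<le> \<rho> p\<close>.\<close>

lemma rees_product_chain_iff:
  assumes "finite r" "Partial_order r" "rank_function r \<rho>" and \<rho>: "\<And>p. p \<in> Field r \<Longrightarrow> \<rho> p < m"
  shows "((p, i), (q, j)) \<in> rees_product r (chain_poset m) \<longleftrightarrow>
    (p, q) \<in> r \<and> i \<le> \<rho> p \<and> j \<le> \<rho> q \<and> i \<le> j \<and> j + \<rho> p \<le> i + \<rho> q"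
proof (cases "(p, q) \<in> r")
  case False
  then show ?thesis by (simp add: rees_product_def)
next
  case pq: True
  then have F: "p \<in> Field r" "q \<in> Field r"
    by (auto simp: Field_def)
  have rk: "poset_rank r p = \<rho> p" "poset_rank r q = \<rho> q"
    using F assms by (auto intro: poset_rank_eq)
  show ?thesis
  proof (cases "i \<le> j \<and> j < m")
    case True
    then have "poset_rank (chain_poset m) i = i" "poset_rank (chain_poset m) j = j"
      by (simp_all add: poset_rank_chain_poset)
    then show ?thesis
      using True pq by (auto simp: rees_product_def rk chain_poset_def)
  next
    case False
    then show ?thesis
      using \<rho>[OF F(2)] by (auto simp: rees_product_def chain_poset_def)
  qed
qed

text \<open>Let \<open>T p\<close> be the sum of the Moebius values over the fibre of pairs \<open>(p, i)\<close> with \<open>i \<le> \<rho> p\<close>.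
  Add up the Moebius recursion at the pairs \<open>(p, j)\<close> of one fibre: a pair \<open>(q, i)\<close> with
  \<open>q \<le> p\<close> lies below \<open>(p, j)\<close> exactly for \<open>i \<le> j \<le> i + (\<rho> p - \<rho> q)\<close>, and all these \<open>j\<close> occur in
  the fibre. The number of them does not depend on \<open>i\<close>, so \<open>T\<close> satisfies a recursion over \<open>r\<close>
  alone. The coefficient of \<open>T p\<close> in it is \<open>1\<close>; hence every solution \<open>S\<close> equals \<open>T\<close>.
  Real-valued solutions are admitted because they will come from a power series.\<close>

lemma moebius_number_rees_product_chain:
  fixes S :: "'a \<Rightarrow> real"
  assumes r: "finite r" "Partial_order r" "rank_function r \<rho>"
    and m: "\<And>p. p \<in> Field r \<Longrightarrow> \<rho> p < m"
    and S: "\<And>p. p \<in> Field r \<Longrightarrow> (\<Sum>q | (q, p) \<in> r. real (\<rho> p - \<rho> q + 1) * S q) = - real (\<rho> p + 1)"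
  shows "moebius_number (adjoin_bounds (rees_product r (chain_poset m))) = - (1 + (\<Sum>p\<in>Field r. S p))"
proof -
  define R where "R = rees_product r (chain_poset m)"
  have R_iff: "((p, i), (q, j)) \<in> R \<longleftrightarrow>
      (p, q) \<in> r \<and> i \<le> \<rho> p \<and> j \<le> \<rho> q \<and> i \<le> j \<and> j + \<rho> p \<le> i + \<rho> q" for p i q j
    unfolding R_def by (rule rees_product_chain_iff[OF r m])
  have po: "refl_on (Field r) r" "trans r" "antisym r"
    using r(2) by (auto simp: partial_order_on_def preorder_on_def)
  have Field_R: "Field R = (SIGMA p:Field r. {..\<rho> p})"
  proof
    show "Field R \<subseteq> (SIGMA p:Field r. {..\<rho> p})"
    proof
      fix x assume "x \<in> Field R"
      then obtain y where "(x, y) \<in> R \<or> (y, x) \<in> R"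
        by (auto simp: Field_def)
      then show "x \<in> (SIGMA p:Field r. {..\<rho> p})"
        by (cases x; cases y) (auto simp: R_iff intro: FieldI1 FieldI2)
    qed
    have "((p, i), (p, i)) \<in> R" if "p \<in> Field r" "i \<le> \<rho> p" for p i
      using that po(1) by (auto simp: R_iff refl_on_def)
    then show "(SIGMA p:Field r. {..\<rho> p}) \<subseteq> Field R"
      by (auto intro: FieldI1)
  qed
  have finF: "finite (Field r)"
    using r(1) by (rule finite_Field)
  have "R \<subseteq> Field R \<times> Field R"
    by (auto simp: Field_def)
  then have finR: "finite R"
    by (rule finite_subset) (simp add: Field_R finF)
  have poR: "Partial_order R"
  proof -
    have "refl_on (Field R) R"
      using po(1) by (auto simp: refl_on_def Field_R R_iff)
    moreover have "trans R"
    proof (rule transI)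
      fix x y z assume "(x, y) \<in> R" "(y, z) \<in> R"
      then show "(x, z) \<in> R"
        by (cases x; cases y; cases z) (auto simp: R_iff intro: transD[OF po(2)])
    qed
    moreover have "antisym R"
    proof (rule antisymI)
      fix x y assume "(x, y) \<in> R" "(y, x) \<in> R"
      then show "x = y"
        by (cases x; cases y) (auto simp: R_iff dest: antisymD[OF po(3)])
    qed
    ultimately show ?thesis
      by (auto simp: partial_order_on_def preorder_on_def Field_def)
  qed
  define \<mu> where "\<mu> x = moebius (adjoin_bounds R) Bottom (Elem x)" for x
  have \<mu>_sum: "(\<Sum>y | (y, x) \<in> R. \<mu> y) = - 1" if "x \<in> Field R" for x
    unfolding \<mu>_def by (rule moebius_adjoin_bounds(1)[OF finR poR that])
  define T where "T p = (\<Sum>i\<le>\<rho> p. \<mu> (p, i))" for p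
  have T: "(\<Sum>q | (q, p) \<in> r. int (\<rho> p - \<rho> q + 1) * T q) = - int (\<rho> p + 1)" if p: "p \<in> Field r" for p
  proof -
    have below: "{q. (q, p) \<in> r} \<subseteq> Field r"
      by (auto intro: FieldI1)
    then have fin: "finite {q. (q, p) \<in> r}"
      using finF by (rule finite_subset)
    have count: "card {j \<in> {..\<rho> p}. ((q, i), (p, j)) \<in> R} = \<rho> p - \<rho> q + 1"
      if q: "(q, p) \<in> r" "i \<le> \<rho> q" for q i
    proof -
      have "\<rho> q \<le> \<rho> p"
        by (rule rank_function_mono[OF r q(1)])
      then have "{j \<in> {..\<rho> p}. ((q, i), (p, j)) \<in> R} = {i..i + (\<rho> p - \<rho> q)}"
        using q by (auto simp: R_iff)
      then show ?thesis by simp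
    qed
    have "- int (\<rho> p + 1) = (\<Sum>j\<le>\<rho> p. \<Sum>y | (y, (p, j)) \<in> R. \<mu> y)"
      using p by (simp add: \<mu>_sum Field_R)
    also have "\<dots> = (\<Sum>j\<le>\<rho> p. \<Sum>y\<in>(SIGMA q:{q. (q, p) \<in> r}. {..\<rho> q}). if (y, (p, j)) \<in> R then \<mu> y else 0)"
      using fin by (intro sum.cong refl sum.mono_neutral_cong_left) (auto simp: R_iff)
    also have "\<dots> = (\<Sum>y\<in>(SIGMA q:{q. (q, p) \<in> r}. {..\<rho> q}). \<Sum>j\<le>\<rho> p. if (y, (p, j)) \<in> R then \<mu> y else 0)"
      by (rule sum.swap)
    also have "\<dots> = (\<Sum>y\<in>(SIGMA q:{q. (q, p) \<in> r}. {..\<rho> q}). int (\<rho> p - \<rho> (fst y) + 1) * \<mu> y)"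
    proof (rule sum.cong[OF refl])
      fix y assume "y \<in> (SIGMA q:{q. (q, p) \<in> r}. {..\<rho> q})"
      then show "(\<Sum>j\<le>\<rho> p. if (y, (p, j)) \<in> R then \<mu> y else 0) = int (\<rho> p - \<rho> (fst y) + 1) * \<mu> y"
        using count[of "fst y" "snd y"] by (auto simp: sum.If_cases Int_def)
    qed
    also have "\<dots> = (\<Sum>q | (q, p) \<in> r. int (\<rho> p - \<rho> q + 1) * T q)"
      using fin by (simp add: T_def sum.Sigma sum_distrib_left case_prod_unfold)
    finally show ?thesis ..
  qed
  have T_eq_S: "real_of_int (T p) = S p" if "p \<in> Field r" for p
    using r(1,2) that
  proof (induction p rule: finite_poset_induct)
    case (less p)
    have fin: "finite {q. (q, p) \<in> r}"
      by (rule finite_subset[OF _ finF]) (auto intro: FieldI1)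
    have split: "(\<Sum>q | (q, p) \<in> r. f q) = f p + (\<Sum>q | (q, p) \<in> r \<and> q \<noteq> p. f q)" for f :: "'a \<Rightarrow> real"
      using less.hyps fin po(1) by (subst sum.remove[of _ p]) (auto simp: refl_on_def intro: sum.cong)
    have "(\<Sum>q | (q, p) \<in> r. real (\<rho> p - \<rho> q + 1) * T q) = (\<Sum>q | (q, p) \<in> r. real (\<rho> p - \<rho> q + 1) * S q)"
      using arg_cong[OF T[OF less.hyps], of real_of_int] S[OF less.hyps] by simp
    moreover have "(\<Sum>q | (q, p) \<in> r \<and> q \<noteq> p. real (\<rho> p - \<rho> q + 1) * T q) =
        (\<Sum>q | (q, p) \<in> r \<and> q \<noteq> p. real (\<rho> p - \<rho> q + 1) * S q)"
      using less.IH by (intro sum.cong refl) simp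
    ultimately show ?case
      unfolding split by simp
  qed
  have "moebius_number (adjoin_bounds R) = - (1 + (\<Sum>x\<in>Field R. \<mu> x))"
    unfolding \<mu>_def by (rule moebius_adjoin_bounds(2)[OF finR poR])
  also have "(\<Sum>x\<in>Field R. \<mu> x) = (\<Sum>p\<in>Field r. T p)"
    using finF by (simp add: Field_R T_def sum.Sigma)
  finally show ?thesis
    by (simp add: T_eq_S flip: R_def)
qed

section \<open>The faces of the cube\<close>

definition vertex :: "'n set \<Rightarrow> real ^ 'n" where
  "vertex A = (\<chi> i. of_bool (i \<in> A))"

text \<open>The face of the cube obtained by fixing the coordinates in \<open>L\<close> to \<open>1\<close> and those outside \<open>U\<close>
  to \<open>0\<close>. For \<open>L \<subseteq> U\<close> the coordinates in \<open>U - L\<close> are free. Inclusion of faces becomes inclusion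
  of intervals in the Boolean lattice.\<close>

definition cube_face :: "'n::finite set \<Rightarrow> 'n set \<Rightarrow> (real ^ 'n) set" where
  "cube_face L U = cbox (vertex L) (vertex U)"

lemma mem_cube_face:
  "x \<in> cube_face L U \<longleftrightarrow> (\<forall>i. of_bool (i \<in> L) \<le> x $ i \<and> x $ i \<le> of_bool (i \<in> U))"
  by (simp add: cube_face_def vertex_def mem_box_cart)

lemma vertex_in_cube_face: "vertex A \<in> cube_face L U \<longleftrightarrow> L \<subseteq> A \<and> A \<subseteq> U"
  by (auto simp: mem_cube_face vertex_def of_bool_def split: if_splits)

lemma cube_face_subset_iff:
  assumes "L \<subseteq> U"
  shows "cube_face L U \<subseteq> cube_face L' U' \<longleftrightarrow> L' \<subseteq> L \<and> U \<subseteq> U'"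
proof
  assume "cube_face L U \<subseteq> cube_face L' U'"
  then have "vertex L \<in> cube_face L' U'" "vertex U \<in> cube_face L' U'"
    using assms vertex_in_cube_face[of _ L U] by blast+
  then show "L' \<subseteq> L \<and> U \<subseteq> U'"
    by (auto simp: vertex_in_cube_face)
next
  assume "L' \<subseteq> L \<and> U \<subseteq> U'"
  then show "cube_face L U \<subseteq> cube_face L' U'"
    unfolding cube_face_def by (intro subset_interval_imp_cart) (auto simp: vertex_def)
qed

lemma cube_face_eq_iff:
  assumes "L \<subseteq> U" "L' \<subseteq> U'"
  shows "cube_face L U = cube_face L' U' \<longleftrightarrow> L = L' \<and> U = U'"
  unfolding set_eq_subset[of "cube_face L U"] cube_face_subset_iff[OF assms(1)]
    cube_face_subset_iff[OF assms(2)]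
  by auto

text \<open>On \<open>[0, 1]\<close> the term \<open>a\<^sub>i x\<^sub>i\<close> is largest at \<open>x\<^sub>i = 1\<close>, anywhere, or at \<open>x\<^sub>i = 0\<close>, according to the
  sign of \<open>a\<^sub>i\<close>. Thus a linear functional is maximized on a cube face, read off from the
  signs of its coefficients.\<close>

lemma cube_supporting_hyperplane:
  fixes a :: "real ^ 'n::finite"
  defines "b \<equiv> \<Sum>i\<in>UNIV. max 0 (a $ i)"
  assumes x: "x \<in> cbox 0 1"
  shows "a \<bullet> x \<le> b"
    and "a \<bullet> x = b \<longleftrightarrow> x \<in> cube_face {i. 0 < a $ i} {i. 0 \<le> a $ i}"
proof -
  have x': "0 \<le> x $ i" "x $ i \<le> 1" for i
    using x by (auto simp: mem_box_cart)
  have diff: "b - a \<bullet> x = (\<Sum>i\<in>UNIV. max 0 (a $ i) - a $ i * x $ i)"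
    by (simp add: b_def inner_vec_def sum_subtractf)
  have le: "a $ i * x $ i \<le> max 0 (a $ i)" for i
    using x'[of i] by (cases "a $ i \<ge> 0") (auto simp: mult_left_le mult_nonpos_nonneg)
  have eq: "max 0 (a $ i) = a $ i * x $ i \<longleftrightarrow> of_bool (0 < a $ i) \<le> x $ i \<and> x $ i \<le> of_bool (0 \<le> a $ i)" for i
    using x'[of i] by (cases "a $ i" "0 :: real" rule: linorder_cases) auto
  have "0 \<le> b - a \<bullet> x"
    unfolding diff using le by (intro sum_nonneg) simp
  then show "a \<bullet> x \<le> b"
    by simp
  have "a \<bullet> x = b \<longleftrightarrow> b - a \<bullet> x = 0"
    by auto
  also have "\<dots> \<longleftrightarrow> (\<forall>i. max 0 (a $ i) = a $ i * x $ i)"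
    unfolding diff using le by (subst sum_nonneg_eq_0_iff) auto
  finally show "a \<bullet> x = b \<longleftrightarrow> x \<in> cube_face {i. 0 < a $ i} {i. 0 \<le> a $ i}"
    unfolding eq by (simp add: mem_cube_face)
qed

lemma cube_face_eq_hyperplane:
  fixes a :: "real ^ 'n::finite"
  shows "cbox 0 1 \<inter> {x. a \<bullet> x = (\<Sum>i\<in>UNIV. max 0 (a $ i))} =
    cube_face {i. 0 < a $ i} {i. 0 \<le> a $ i}"
proof -
  have "cube_face {i. 0 < a $ i} {i. 0 \<le> a $ i} \<subseteq> cube_face {} UNIV"
    by (subst cube_face_subset_iff) auto
  also have "\<dots> = cbox 0 1"
    by (auto simp: mem_cube_face mem_box_cart)
  finally show ?thesis
    using cube_supporting_hyperplane(2) by blast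
qed

text \<open>Faces of a polytope are exposed, so a nonempty face is where some linear functional
  attains its maximum on the cube. Conversely, coefficients \<open>1\<close> on \<open>L\<close>, \<open>0\<close> on \<open>U - L\<close> and \<open>-1\<close>
  elsewhere expose \<open>cube_face L U\<close>.\<close>

lemma face_of_cube_iff:
  fixes F :: "(real ^ 'n::finite) set"
  shows "F face_of cbox 0 1 \<and> F \<noteq> {} \<longleftrightarrow> (\<exists>L U. L \<subseteq> U \<and> F = cube_face L U)"
proof
  assume F: "F face_of cbox 0 1 \<and> F \<noteq> {}"
  then have "F exposed_face_of cbox 0 1"
    by (simp add: exposed_face_of_polyhedron)
  then obtain a b where ab: "cbox 0 1 \<subseteq> {x. a \<bullet> x \<le> b}" and F_eq: "F = cbox 0 1 \<inter> {x. a \<bullet> x = b}"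
    by (auto simp: exposed_face_of_def)
  define m where "m = (\<Sum>i\<in>UNIV. max 0 (a $ i))"
  obtain x where "x \<in> cbox 0 1" "a \<bullet> x = b"
    using F F_eq by auto
  then have "b \<le> m"
    using cube_supporting_hyperplane(1)[of x a] by (simp add: m_def)
  \<comment> \<open>The vertex at which the positive coefficients are switched on attains \<open>m\<close>.\<close>
  moreover have "m \<le> b"
  proof -
    have "vertex {i. 0 < a $ i} \<in> cube_face {i. 0 < a $ i} {i. 0 \<le> a $ i}"
      by (auto simp: vertex_in_cube_face)
    then have "vertex {i. 0 < a $ i} \<in> cbox 0 1 \<inter> {x. a \<bullet> x = m}"
      unfolding m_def cube_face_eq_hyperplane .
    then show ?thesis
      using ab by auto
  qed
  ultimately have "F = cube_face {i. 0 < a $ i} {i. 0 \<le> a $ i}"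
    using cube_face_eq_hyperplane[of a] by (simp add: F_eq m_def)
  then show "\<exists>L U. L \<subseteq> U \<and> F = cube_face L U"
    by (intro exI conjI) auto
next
  assume "\<exists>L U. L \<subseteq> U \<and> F = cube_face L U"
  then obtain L U where LU: "L \<subseteq> U" "F = cube_face L U"
    by blast
  define a :: "real ^ 'n" where "a = (\<chi> i. if i \<in> L then 1 else if i \<in> U then 0 else - 1)"
  have "{i. 0 < a $ i} = L" "{i. 0 \<le> a $ i} = U"
    using LU(1) by (auto simp: a_def)
  then have "F = cbox 0 1 \<inter> {x. a \<bullet> x = (\<Sum>i\<in>UNIV. max 0 (a $ i))}"
    using cube_face_eq_hyperplane[of a] LU(2) by simp
  moreover have "\<dots> face_of cbox 0 1"
    by (intro face_of_Int_supporting_hyperplane_le convex_box cube_supporting_hyperplane(1))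
  moreover have "F \<noteq> {}"
    using vertex_in_cube_face[of L L U] LU by auto
  ultimately show "F face_of cbox 0 1 \<and> F \<noteq> {}"
    by simp
qed

definition cube_faces :: "(real ^ 'n::finite) set set" where
  "cube_faces = {cube_face L U |L U. L \<subseteq> U}"

lemma cube_facesI: "L \<subseteq> U \<Longrightarrow> cube_face L U \<in> cube_faces"
  unfolding cube_faces_def by (rule CollectI, rule exI, rule exI, rule conjI, rule refl)

lemma remove_least_cubical_lattice:
  "remove_least (cubical_lattice :: (real ^ 'n::finite) set rel) =
    {(F, G). F \<in> cube_faces \<and> G \<in> cube_faces \<and> F \<subseteq> G}"
proof -
  let ?r = "cubical_lattice :: (real ^ 'n) set rel"
  have F: "Field ?r = {F. F face_of cbox 0 1}"
    by (auto simp: cubical_lattice_def Field_def)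
  have "antisym ?r"
    by (auto simp: cubical_lattice_def antisym_def)
  then have "least_elem ?r = {}"
    by (rule least_elem_eqI) (simp_all add: F, simp add: cubical_lattice_def)
  moreover have "F \<in> cube_faces \<longleftrightarrow> F face_of cbox 0 1 \<and> F \<noteq> {}" for F :: "(real ^ 'n) set"
    unfolding face_of_cube_iff by (auto simp: cube_faces_def)
  ultimately show ?thesis
    unfolding remove_least_def F by (auto simp: cubical_lattice_def)
qed

text \<open>The size of this set is the dimension of a cube face. Defining it from the face as a set of
  points gives a rank function without choosing \<open>L\<close> and \<open>U\<close>.\<close>

definition varying_coordinates :: "(real ^ 'n) set \<Rightarrow> 'n set" where
  "varying_coordinates F = {i. \<exists>x\<in>F. \<exists>y\<in>F. x $ i \<noteq> y $ i}"

lemma varying_coordinates_cube_face: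
  assumes "L \<subseteq> U"
  shows "varying_coordinates (cube_face L U) = U - L"
proof
  show "varying_coordinates (cube_face L U) \<subseteq> U - L"
  proof
    fix i assume "i \<in> varying_coordinates (cube_face L U)"
    then obtain x y where xy: "x \<in> cube_face L U" "y \<in> cube_face L U" "x $ i \<noteq> y $ i"
      by (auto simp: varying_coordinates_def)
    show "i \<in> U - L"
    proof (rule ccontr)
      assume "i \<notin> U - L"
      then have "of_bool (i \<in> L) = (of_bool (i \<in> U) :: real)"
        using assms by auto
      then show False
        using xy unfolding mem_cube_face by (metis order_antisym_conv order_trans)
    qed
  qed
  show "U - L \<subseteq> varying_coordinates (cube_face L U)"
  proof
    fix i assume "i \<in> U - L"
    then have "vertex L $ i \<noteq> vertex U $ i"
      by (simp add: vertex_def)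
    moreover have "vertex L \<in> cube_face L U" "vertex U \<in> cube_face L U"
      using assms by (simp_all add: vertex_in_cube_face)
    ultimately show "i \<in> varying_coordinates (cube_face L U)"
      unfolding varying_coordinates_def by blast
  qed
qed

lemma finite_cube_faces: "finite (cube_faces :: (real ^ 'n::finite) set set)"
proof -
  have "(cube_faces :: (real ^ 'n) set set) \<subseteq> (\<lambda>(L, U). cube_face L U) ` UNIV"
    by (auto simp: cube_faces_def)
  then show ?thesis
    by (rule finite_subset) simp
qed

lemma nonempty_face_poset:
  defines "r \<equiv> remove_least (cubical_lattice :: (real ^ 'n::finite) set rel)"
  shows "Field r = cube_faces" "finite r" "Partial_order r"
    "rank_function r (\<lambda>F. card (varying_coordinates F))"
proof -
  note r = remove_least_cubical_lattice[where 'n = 'n, folded r_def]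
  show F: "Field r = cube_faces"
    by (auto simp: r Field_def)
  show "finite r"
    by (rule finite_subset[of _ "cube_faces \<times> cube_faces"]) (auto simp: r finite_cube_faces)
  show "Partial_order r"
    unfolding partial_order_on_def preorder_on_def F
    by (auto simp: r refl_on_def trans_def antisym_def)
  show "rank_function r (\<lambda>F. card (varying_coordinates F))"
    unfolding rank_function_def F
  proof (intro conjI ballI allI impI)
    fix F assume "F \<in> cube_faces" and min: "\<forall>G. (G, F) \<in> r \<longrightarrow> G = F"
    then obtain L U where LU: "L \<subseteq> U" "F = cube_face L U"
      by (auto simp: cube_faces_def)
    have "(cube_face L L, F) \<in> r"
      using LU by (auto simp: r cube_faces_def cube_face_subset_iff)
    then have "cube_face L L = F"
      using min by blast
    then have "varying_coordinates F = {}"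
      using varying_coordinates_cube_face[of L L] by simp
    then show "card (varying_coordinates F) = 0"
      by simp
  next
    fix G F assume cov: "covered_by r G F"
    then have "(G, F) \<in> r" "G \<noteq> F"
      by (auto simp: covered_by_def)
    then obtain L U L' U' where LU: "L \<subseteq> U" "F = cube_face L U" "L' \<subseteq> U'" "G = cube_face L' U'"
      by (auto simp: r cube_faces_def)
    have sub: "L \<subseteq> L'" "U' \<subseteq> U"
      using \<open>(G, F) \<in> r\<close> LU by (auto simp: r cube_face_subset_iff)
    \<comment> \<open>A cover admits no interval strictly between. Shrinking \<open>[L, U]\<close> by a single coordinate
      towards \<open>[L', U']\<close> must therefore reach \<open>[L', U']\<close> at once.\<close>
    have between: "A = L' \<and> B = U'"
      if "L \<subseteq> A" "A \<subseteq> L'" "U' \<subseteq> B" "B \<subseteq> U" "A \<noteq> L \<or> B \<noteq> U" for A B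
    proof -
      have AB: "A \<subseteq> B" using that LU by blast
      then have "(G, cube_face A B) \<in> r" "(cube_face A B, F) \<in> r"
        using that LU by (auto simp: r cube_faces_def cube_face_subset_iff)
      then have "cube_face A B = G \<or> cube_face A B = F"
        using cov unfolding covered_by_def by blast
      then show ?thesis
        using that(5) unfolding LU cube_face_eq_iff[OF AB LU(1)] cube_face_eq_iff[OF AB LU(3)] by blast
    qed
    have "\<exists>i. i \<in> U - L \<and> U' - L' = U - L - {i}"
    proof (cases "L = L'")
      case True
      then have "U' \<noteq> U"
        using \<open>G \<noteq> F\<close> LU by auto
      then obtain i where "i \<in> U" "i \<notin> U'"
        using sub by auto
      moreover from this have "U - {i} = U'"
        using between[of L "U - {i}"] sub True by auto
      ultimately show ?thesis
        using True LU by (intro exI[of _ i]) auto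
    next
      case False
      then obtain i where "i \<in> L'" "i \<notin> L"
        using sub by auto
      moreover from this have "insert i L = L' \<and> U = U'"
        using between[of "insert i L" U] sub by auto
      ultimately show ?thesis
        using LU by (intro exI[of _ i]) auto
    qed
    then obtain i where "i \<in> U - L" "U' - L' = U - L - {i}"
      by blast
    then have "card (U - L) = card (U' - L') + 1"
      using card.remove[of "U - L" i] by simp
    then show "card (varying_coordinates F) = card (varying_coordinates G) + 1"
      unfolding LU varying_coordinates_cube_face[OF LU(1)] varying_coordinates_cube_face[OF LU(3)] .
  qed
qed

lemma sum_Pow_card:
  fixes g :: "nat \<Rightarrow> 'b::comm_semiring_1"
  assumes "finite K"
  shows "(\<Sum>D\<in>Pow K. g (card D)) = (\<Sum>i\<le>card K. of_nat (card K choose i) * g i)"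
proof -
  have "(\<Sum>D\<in>Pow K. g (card D)) = (\<Sum>i\<le>card K. \<Sum>D | D \<in> Pow K \<and> card D = i. g (card D))"
    using assms by (intro sum.group[symmetric]) (auto intro: card_mono)
  also have "\<dots> = (\<Sum>i\<le>card K. of_nat (card K choose i) * g i)"
    using n_subsets[OF assms] by (intro sum.cong) auto
  finally show ?thesis .
qed

text \<open>A subface is determined by the set \<open>D\<close> of coordinates that stay free and the set \<open>E\<close> of the
  newly fixed coordinates with value \<open>1\<close>. For \<open>D\<close> of size \<open>i\<close> there are \<open>2 ^ (k - i)\<close> choices of \<open>E\<close>.\<close>

lemma sum_subfaces:
  fixes h :: "nat \<Rightarrow> real"
  assumes "L \<subseteq> (U :: 'n::finite set)"
  defines "k \<equiv> card (U - L)"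
  shows "(\<Sum>G | G \<in> cube_faces \<and> G \<subseteq> cube_face L U. h (card (varying_coordinates G))) =
    (\<Sum>i\<le>k. real (k choose i) * 2 ^ (k - i) * h i)"
proof -
  define K where "K = U - L"
  let ?I = "SIGMA D:Pow K. Pow (K - D)"
  let ?f = "\<lambda>(D, E). cube_face (L \<union> E) (L \<union> E \<union> D)"
  have bij: "bij_betw ?f ?I {G. G \<in> cube_faces \<and> G \<subseteq> cube_face L U}"
    unfolding bij_betw_def
  proof
    show "inj_on ?f ?I"
    proof (rule inj_onI, clarify)
      fix D E D' E' assume DE: "D \<subseteq> K" "E \<subseteq> K - D" "D' \<subseteq> K" "E' \<subseteq> K - D'"
        and faces: "cube_face (L \<union> E) (L \<union> E \<union> D) = cube_face (L \<union> E') (L \<union> E' \<union> D')"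
      have "L \<union> E = L \<union> E' \<and> L \<union> E \<union> D = L \<union> E' \<union> D'"
        by (rule cube_face_eq_iff[THEN iffD1, OF _ _ faces]) (rule Un_upper1)+
      then have eq: "L \<union> E = L \<union> E'" "L \<union> E \<union> D = L \<union> E' \<union> D'"
        by (rule conjunct1, rule conjunct2)
      have "E = (L \<union> E) - L"
        using DE by (auto simp: K_def)
      also have "\<dots> = E'"
        unfolding eq(1) using DE by (auto simp: K_def)
      finally have "E = E'" .
      have "D = (L \<union> E \<union> D) - (L \<union> E)"
        using DE by (auto simp: K_def)
      also have "\<dots> = (L \<union> E' \<union> D') - (L \<union> E')"
        by (rule arg_cong2[where f = minus, OF eq(2) eq(1)])
      also have "\<dots> = D'"
        using DE by (auto simp: K_def)
      finally show "D = D' \<and> E = E'"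
        using \<open>E = E'\<close> by simp
    qed
    show "?f ` ?I = {G. G \<in> cube_faces \<and> G \<subseteq> cube_face L U}"
    proof
      show "?f ` ?I \<subseteq> {G. G \<in> cube_faces \<and> G \<subseteq> cube_face L U}"
      proof (clarify, intro conjI)
        fix D E assume DE: "D \<subseteq> K" "E \<subseteq> K - D"
        show "cube_face (L \<union> E) (L \<union> E \<union> D) \<in> cube_faces"
          by (rule cube_facesI) simp
        show "cube_face (L \<union> E) (L \<union> E \<union> D) \<subseteq> cube_face L U"
          using DE assms(1) by (subst cube_face_subset_iff) (auto simp: K_def)
      qed
      show "{G. G \<in> cube_faces \<and> G \<subseteq> cube_face L U} \<subseteq> ?f ` ?I"
      proof
        fix G assume "G \<in> {G. G \<in> cube_faces \<and> G \<subseteq> cube_face L U}"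
        then obtain A B where AB: "A \<subseteq> B" "G = cube_face A B" "G \<subseteq> cube_face L U"
          by (auto simp: cube_faces_def)
        then have LU: "L \<subseteq> A" "B \<subseteq> U"
          by (simp_all add: cube_face_subset_iff)
        have "L \<union> (A - L) = A" "A \<union> (B - A) = B"
          using AB(1) LU by auto
        then have "G = ?f (B - A, A - L)"
          using AB(2) by simp
        moreover have "(B - A, A - L) \<in> ?I"
          using AB(1) LU by (auto simp: K_def)
        ultimately show "G \<in> ?f ` ?I"
          by (rule image_eqI)
      qed
    qed
  qed
  have "(\<Sum>G | G \<in> cube_faces \<and> G \<subseteq> cube_face L U. h (card (varying_coordinates G))) =
      (\<Sum>x\<in>?I. h (card (varying_coordinates (?f x))))"
    by (rule sum.reindex_bij_betw[OF bij, symmetric])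
  also have "\<dots> = (\<Sum>x\<in>?I. h (card (fst x)))"
  proof (rule sum.cong[OF refl])
    fix x assume x: "x \<in> ?I"
    then have "L \<union> snd x \<union> fst x - (L \<union> snd x) = fst x"
      by (auto simp: K_def)
    then show "h (card (varying_coordinates (?f x))) = h (card (fst x))"
      by (simp add: case_prod_unfold varying_coordinates_cube_face)
  qed
  also have "\<dots> = (\<Sum>D\<in>Pow K. 2 ^ (card K - card D) * h (card D))"
  proof -
    have "(\<Sum>x\<in>?I. h (card (fst x))) = (\<Sum>D\<in>Pow K. \<Sum>E\<in>Pow (K - D). h (card D))"
      by (subst sum.Sigma) (simp_all add: case_prod_unfold)
    also have "\<dots> = (\<Sum>D\<in>Pow K. 2 ^ (card K - card D) * h (card D))"
      by (intro sum.cong refl) (auto simp: card_Pow card_Diff_subset)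
    finally show ?thesis .
  qed
  also have "\<dots> = (\<Sum>i\<le>k. real (k choose i) * (2 ^ (k - i) * h i))"
    by (subst sum_Pow_card) (simp_all add: K_def k_def)
  finally show ?thesis
    by (simp add: mult.assoc)
qed

section \<open>Generating function of the composition sums\<close>

lemma compositions_0: "compositions 0 = {[]}"
proof -
  have "c = []" if "c \<in> compositions 0" for c
    using that by (cases c) (auto simp: compositions_def)
  then show ?thesis
    by (auto simp: compositions_def)
qed

lemma compositions_conv_Cons:
  assumes "n \<ge> 1"
  shows "compositions n = (\<lambda>(m, c). m # c) ` (SIGMA m:{1..n}. compositions (n - m))"
proof (rule set_eqI)
  fix c
  show "c \<in> compositions n \<longleftrightarrow> c \<in> (\<lambda>(m, c). m # c) ` (SIGMA m:{1..n}. compositions (n - m))"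
    using assms by (cases c) (auto simp: compositions_def image_iff)
qed

lemma finite_compositions: "finite (compositions n)"
proof (induction n rule: less_induct)
  case (less n)
  show ?case
  proof (cases "n = 0")
    case False
    then show ?thesis
      using less by (subst compositions_conv_Cons) (auto intro!: finite_imageI)
  qed (simp add: compositions_0)
qed

lemma sum_compositions_Cons:
  fixes f :: "nat \<Rightarrow> nat list \<Rightarrow> 'b::comm_monoid_add"
  assumes "n \<ge> 1"
  shows "(\<Sum>c\<in>compositions n. f (hd c) (tl c)) = (\<Sum>m=1..n. \<Sum>c\<in>compositions (n - m). f m c)"
proof -
  have "inj_on (\<lambda>(m, c). m # c) (SIGMA m:{1..n}. compositions (n - m))"
    by (auto simp: inj_on_def)
  then have "(\<Sum>c\<in>compositions n. f (hd c) (tl c)) =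
      (\<Sum>(m, c)\<in>(SIGMA m:{1..n}. compositions (n - m)). f m c)"
    by (simp add: compositions_conv_Cons[OF assms] sum.reindex case_prod_unfold)
  then show ?thesis
    by (simp add: sum.Sigma finite_compositions)
qed

text \<open>Splitting off the first part of a composition shows that the series \<open>U\<close> of products over
  compositions satisfies \<open>U = 1 + B U\<close>.\<close>

lemma sum_compositions_prod:
  fixes B :: "'b::comm_ring_1 fps"
  assumes "fps_nth B 0 = 0"
  defines "U \<equiv> Abs_fps (\<lambda>n. \<Sum>c\<in>compositions n. \<Prod>m\<leftarrow>c. fps_nth B m)"
  shows "U * (1 - B) = 1"
proof -
  have "U = 1 + B * U"
  proof (rule fps_ext)
    fix n show "fps_nth U n = fps_nth (1 + B * U) n"
    proof (cases "n = 0")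
      case False
      then have "fps_nth U n = (\<Sum>c\<in>compositions n. fps_nth B (hd c) * (\<Prod>m\<leftarrow>tl c. fps_nth B m))"
        unfolding U_def fps_nth_Abs_fps
        by (intro sum.cong refl) (auto simp: compositions_conv_Cons)
      also have "\<dots> = (\<Sum>m=1..n. fps_nth B m * fps_nth U (n - m))"
        using False by (subst sum_compositions_Cons) (auto simp: U_def sum_distrib_left)
      also have "\<dots> = fps_nth (1 + B * U) n"
        using False assms(1) by (simp add: fps_mult_nth sum.atLeast_Suc_atMost)
      finally show ?thesis .
    qed (simp add: U_def compositions_0 assms)
  qed
  then show ?thesis by (simp add: algebra_simps)
qed

lemma real_multinomial:
  "real (multinomial c) = fact (sum_list c) / (\<Prod>m\<leftarrow>c. fact m)"
proof -
  have "prod_list (map fact c) dvd (fact (sum_list c) :: nat)"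
  proof (induction c)
    case (Cons a c)
    then have "fact a * prod_list (map fact c) dvd (fact a * fact (sum_list c) :: nat)"
      by (intro mult_dvd_mono) auto
    also have "\<dots> dvd fact (a + sum_list c)"
      by (rule fact_fact_dvd_fact)
    finally show ?case by simp
  qed simp
  moreover have "real (prod_list (map fact c)) = (\<Prod>m\<leftarrow>c. fact m)"
    by (induction c) auto
  ultimately show ?thesis
    unfolding multinomial_def by (simp add: real_of_nat_div)
qed

definition composition_sum :: "nat \<Rightarrow> int" where
  "composition_sum n = (\<Sum>c\<in>compositions n.
       2 ^ (n - c ! 0) * int (multinomial c) * int (c ! 0) *
       (\<Prod>i = 1..<length c. int (c ! i) - 1))"

text \<open>Multiplying by \<open>a\<close> on the left-hand side avoids the truncated exponent \<open>m - 1\<close>.\<close>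

lemma fps_nth_X_mult_exp:
  "fps_nth (fps_X * fps_exp a) m * a = of_nat m * a ^ m / (fact m :: 'a::field_char_0)"
  by (cases m) (simp_all add: field_simps del: of_nat_Suc)

text \<open>After division by \<open>n!\<close> the summand of a composition is a product over its parts: a factor
  \<open>m / m!\<close> for the first part and \<open>(m - 1) 2\<^sup>m / m!\<close> for every later one. The corresponding
  series are \<open>A = x e\<^sup>x\<close> and \<open>B = 1 - (1 - 2 x) e\<^bsup>2x\<^esup>\<close>, and the generating function is
  \<open>A / (1 - B) = x e\<^bsup>-x\<^esup> / (1 - 2 x)\<close>. The coefficient at \<open>0\<close> is set separately because the empty
  composition has no first part.\<close>

lemma egf_composition_sum:
  "Abs_fps (\<lambda>n. if n = 0 then 0 else real_of_int (composition_sum n) / fact n) * (1 - 2 * fps_X) = fps_X * fps_exp (-1)"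
proof -
  define B :: "real fps" where "B = 1 - (1 - 2 * fps_X) * fps_exp 2"
  define A :: "real fps" where "A = fps_X * fps_exp 1"
  have B: "fps_nth B m = (if m = 0 then 0 else (real m - 1) * 2 ^ m / fact m)" for m
  proof -
    have "B = 1 - fps_exp 2 + fps_const 2 * (fps_X * fps_exp 2)"
      by (simp add: B_def algebra_simps numeral_fps_const)
    then have "fps_nth B m = (if m = 0 then 1 else 0) - 2 ^ m / fact m + fps_nth (fps_X * fps_exp 2) m * 2"
      by (simp del: fps_X_mult_nth)
    then show ?thesis
      unfolding fps_nth_X_mult_exp by (cases "m = 0") (simp_all add: algebra_simps diff_divide_distrib)
  qed
  have A: "fps_nth A m = real m / fact m" for m
    using fps_nth_X_mult_exp[of "1::real" m] by (simp only: A_def mult_1_right power_one)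
  define U where "U = Abs_fps (\<lambda>n. \<Sum>c\<in>compositions n. \<Prod>m\<leftarrow>c. fps_nth B m)"
  have U: "U * (1 - B) = 1"
    unfolding U_def by (rule sum_compositions_prod) (simp add: B)
  have *: "Abs_fps (\<lambda>n. if n = 0 then 0 else real_of_int (composition_sum n) / fact n) = A * U"
  proof (rule fps_ext)
    fix n
    show "fps_nth (Abs_fps (\<lambda>n. if n = 0 then 0 else real_of_int (composition_sum n) / fact n)) n = fps_nth (A * U) n"
    proof (cases "n = 0")
      case True
      then show ?thesis by (simp add: A)
    next
      case False
      have "real_of_int (2 ^ (n - c ! 0) * int (multinomial c) * int (c ! 0) *
           (\<Prod>i = 1..<length c. int (c ! i) - 1)) / fact n =
         fps_nth A (hd c) * (\<Prod>m\<leftarrow>tl c. fps_nth B m)" if c: "c \<in> compositions n" for c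
      proof -
        obtain m c' where c_eq: "c = m # c'"
          using c False by (cases c) (auto simp: compositions_def)
        have n: "n = m + sum_list c'" and pos: "\<And>i. i \<in> set c' \<Longrightarrow> i \<ge> 1"
          using c by (auto simp: c_eq compositions_def)
        have "(\<Prod>i = 1..<length c. int (c ! i) - 1) = (\<Prod>i\<leftarrow>c'. int i - 1)"
          using prod.atLeast_Suc_lessThan_Suc_shift[of "\<lambda>i. int (c ! i) - 1" 0 "length c'"]
          by (simp add: c_eq prod.list_conv_set_nth atLeast0LessThan del: prod.op_ivl_Suc)
        moreover have "(\<Prod>i\<leftarrow>c'. fps_nth B i) * (\<Prod>i\<leftarrow>c'. fact i) =
            2 ^ sum_list c' * real_of_int (\<Prod>i\<leftarrow>c'. int i - 1)"
          using pos
        proof (induction c')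
          case (Cons a c')
          then have "fps_nth B a * fact a = 2 ^ a * (real a - 1)"
            using order.strict_trans2[OF zero_less_one Cons.prems[of a]] by (simp add: B)
          with Cons show ?case by (simp add: power_add mult_ac)
        qed simp
        moreover have "(\<Prod>i\<leftarrow>c'. fact i) \<noteq> (0 :: real)"
          by (induction c') auto
        ultimately show ?thesis
          by (simp add: c_eq A real_multinomial n field_simps)
      qed
      then have "real_of_int (composition_sum n) / fact n =
          (\<Sum>c\<in>compositions n. fps_nth A (hd c) * (\<Prod>m\<leftarrow>tl c. fps_nth B m))"
        unfolding composition_sum_def of_int_sum sum_divide_distrib by (intro sum.cong refl)
      also have "\<dots> = (\<Sum>m=1..n. fps_nth A m * fps_nth U (n - m))"
        using False by (subst sum_compositions_Cons) (auto simp: U_def sum_distrib_left)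
      also have "\<dots> = fps_nth (A * U) n"
        by (simp add: fps_mult_nth sum.atLeast_Suc_atMost A)
      finally show ?thesis using False by simp
    qed
  qed
  have e: "fps_exp 2 * fps_exp (-1) = fps_exp (1::real)"
    by (simp flip: fps_exp_add_mult)
  have "A * U * (1 - 2 * fps_X) = A * U * ((1 - 2 * fps_X) * fps_exp 2) * fps_exp (-2)"
    by (simp add: mult.assoc flip: fps_exp_add_mult)
  also have "\<dots> = fps_X * (fps_exp 1 * fps_exp (-2)) * (U * (1 - B))"
    unfolding B_def A_def by (simp add: algebra_simps)
  also have "\<dots> = fps_X * fps_exp (-1)"
    unfolding U by (simp flip: fps_exp_add_mult)
  finally show ?thesis unfolding * .
qed

section \<open>Generating function of the Moebius numbers\<close>

text \<open>The exponential generating function \<open>G\<close> of the fibre sums of the Moebius function. The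
  recursion \<open>\<Sum>i\<le>k. (k choose i) 2\<^bsup>k-i\<^esup> (k - i + 1) s\<^sub>i = - (k + 1)\<close> says
  \<open>G (1 + 2 x) e\<^bsup>2x\<^esup> = - (1 + x) e\<^sup>x\<close>; the definition solves this for \<open>G\<close>.\<close>

definition face_weight_egf :: "real fps" where
  "face_weight_egf = - ((1 + fps_X) * fps_exp (-1)) * inverse (1 + 2 * fps_X)"

definition face_weight :: "nat \<Rightarrow> real" where
  "face_weight k = fact k * fps_nth face_weight_egf k"

lemma binomial_convolution_egf:
  fixes f g :: "real fps"
  shows "(\<Sum>i\<le>k. (k choose i) * (fact (k - i) * fps_nth g (k - i)) * (fact i * fps_nth f i)) =
    fact k * fps_nth (f * g) k"
  unfolding fps_mult_nth sum_distrib_left atMost_atLeast0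
  by (intro sum.cong refl) (simp add: binomial_fact field_simps)

lemma face_weight_egf_mult:
  "face_weight_egf * (1 + 2 * fps_X) = - ((1 + fps_X) * fps_exp (-1))"
proof -
  have "inverse (1 + 2 * fps_X) * (1 + 2 * fps_X :: real fps) = 1"
    by (intro inverse_mult_eq_1) simp
  then show ?thesis
    by (simp add: face_weight_egf_def mult.assoc)
qed

lemma face_weight_recurrence:
  "(\<Sum>i\<le>k. real (k choose i) * 2 ^ (k - i) * (real (k - i + 1) * face_weight i)) = - real (k + 1)"
proof -
  define H :: "real fps" where "H = (1 + 2 * fps_X) * fps_exp 2"
  have H: "fact m * fps_nth H m = real (m + 1) * 2 ^ m" for m
  proof -
    have "H = fps_exp 2 + fps_const 2 * (fps_X * fps_exp 2)"
      by (simp add: H_def algebra_simps numeral_fps_const)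
    then have "fps_nth H m = 2 ^ m / fact m + fps_nth (fps_X * fps_exp 2) m * 2"
      by (simp del: fps_X_mult_nth)
    then show ?thesis
      unfolding fps_nth_X_mult_exp by (simp add: field_simps)
  qed
  have "face_weight_egf * H = - ((1 + fps_X) * (fps_exp (-1) * fps_exp 2))"
    unfolding H_def mult.assoc[symmetric] face_weight_egf_mult by simp
  also have "fps_exp (-1) * fps_exp 2 = fps_exp (1::real)"
    by (simp flip: fps_exp_add_mult)
  finally have GH: "face_weight_egf * H = - (fps_exp 1 + fps_X * fps_exp 1)"
    by (simp only: distrib_right mult_1_left)
  have "(\<Sum>i\<le>k. real (k choose i) * 2 ^ (k - i) * (real (k - i + 1) * face_weight i)) =
      (\<Sum>i\<le>k. (k choose i) * (fact (k - i) * fps_nth H (k - i)) * (fact i * fps_nth face_weight_egf i))"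
    by (simp add: H face_weight_def mult_ac)
  also have "\<dots> = fact k * fps_nth (face_weight_egf * H) k"
    by (rule binomial_convolution_egf)
  also have "fps_nth (face_weight_egf * H) k = - (1 / fact k + real k / fact k)"
    using fps_nth_X_mult_exp[of "1::real" k] by (simp add: GH del: fps_X_mult_nth)
  also have "fact k * - (1 / fact k + real k / fact k) = - real (k + 1)"
    by (simp add: field_simps)
  finally show ?thesis .
qed

text \<open>The left-hand sides have exponential generating function
  \<open>M = e\<^sup>x + G e\<^bsup>2x\<^esup> = x e\<^sup>x / (1 + 2 x)\<close>. Substituting \<open>-x\<close> for \<open>x\<close> turns it into the negative of
  the series \<open>W\<close> of the composition sums. In coefficients this substitution is an induction:
  both series satisfy a first-order recursion.\<close>

lemma face_weight_total:
  assumes "n \<ge> 1"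
  shows "1 + (\<Sum>i\<le>n. real (n choose i) * 2 ^ (n - i) * face_weight i) =
    (- 1) ^ Suc n * real_of_int (composition_sum n)"
proof -
  define M where "M = fps_exp 1 + face_weight_egf * fps_exp 2"
  define W where "W = Abs_fps (\<lambda>n. if n = 0 then 0 else real_of_int (composition_sum n) / fact n)"
  have "M * (1 + 2 * fps_X) =
      fps_exp 1 * (1 + 2 * fps_X) + (face_weight_egf * (1 + 2 * fps_X)) * fps_exp 2"
    by (simp add: M_def algebra_simps)
  also have "\<dots> = fps_exp 1 * (1 + 2 * fps_X) - (1 + fps_X) * (fps_exp (-1) * fps_exp 2)"
    unfolding face_weight_egf_mult by (simp add: mult.assoc)
  also have "fps_exp (-1) * fps_exp 2 = fps_exp (1::real)"
    by (simp flip: fps_exp_add_mult)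
  finally have M: "M * (1 + 2 * fps_X) = fps_X * fps_exp 1"
    by (simp add: algebra_simps)
  have W: "W * (1 - 2 * fps_X) = fps_X * fps_exp (-1)"
    unfolding W_def by (rule egf_composition_sum)
  have "fps_nth M m = (- 1) ^ Suc m * fps_nth W m" for m
  proof (induction m)
    case 0
    show ?case
      using arg_cong[OF M, of "\<lambda>f. fps_nth f 0"] arg_cong[OF W, of "\<lambda>f. fps_nth f 0"] by simp
  next
    case (Suc m)
    have "M * (1 + 2 * fps_X) = M + fps_const 2 * (fps_X * M)"
      "W * (1 - 2 * fps_X) = W - fps_const 2 * (fps_X * W)"
      by (simp_all add: algebra_simps numeral_fps_const)
    then have "fps_nth M (Suc m) + 2 * fps_nth M m = 1 / fact m"
      "fps_nth W (Suc m) - 2 * fps_nth W m = (- 1) ^ m / fact m"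
      using arg_cong[OF M, of "\<lambda>f. fps_nth f (Suc m)"] arg_cong[OF W, of "\<lambda>f. fps_nth f (Suc m)"]
      by (simp_all del: fps_X_mult_right_nth)
    then have "fps_nth M (Suc m) = 1 / fact m + 2 * (- 1) ^ m * fps_nth W m"
      "fps_nth W (Suc m) = (- 1) ^ m / fact m + 2 * fps_nth W m"
      using Suc.IH by auto
    then show ?case
      by (simp add: algebra_simps flip: power_add power_mult_distrib)
  qed
  then have "fact n * fps_nth M n = (- 1) ^ Suc n * real_of_int (composition_sum n)"
    using assms by (simp add: W_def)
  moreover have "fact n * fps_nth (face_weight_egf * fps_exp 2) n =
      (\<Sum>i\<le>n. real (n choose i) * 2 ^ (n - i) * face_weight i)"
    by (subst binomial_convolution_egf[symmetric]) (simp add: face_weight_def)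
  then have "fact n * fps_nth M n = 1 + (\<Sum>i\<le>n. real (n choose i) * 2 ^ (n - i) * face_weight i)"
    by (simp add: M_def distrib_left)
  ultimately show ?thesis by simp
qed

theorem theorem5p3:
  fixes n :: nat
  assumes "n \<ge> 1" and "CARD('n::finite) = n"
  shows "moebius_number (Rees (cubical_lattice :: (real ^ 'n) set rel) (chain_poset (n + 1))) =
    (- 1) ^ n *
    (\<Sum>c\<in>compositions n.
       2 ^ (n - c ! 0) * int (multinomial c) * int (c ! 0) *
       (\<Prod>i = 1..<length c. int (c ! i) - 1))"
proof -
  define r where "r = remove_least (cubical_lattice :: (real ^ 'n) set rel)"
  let ?dim = "\<lambda>F :: (real ^ 'n) set. card (varying_coordinates F)"
  note poset = nonempty_face_poset[where 'n = 'n, folded r_def]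
  have r: "r = {(F, G). F \<in> cube_faces \<and> G \<in> cube_faces \<and> F \<subseteq> G}"
    unfolding r_def by (rule remove_least_cubical_lattice)
  have "?dim F \<le> n" for F
    using card_mono[of UNIV "varying_coordinates F"] assms(2) by simp
  then have dim: "?dim F < n + 1" for F
    by (simp add: less_Suc_eq_le)
  have rec: "(\<Sum>G | (G, F) \<in> r. real (?dim F - ?dim G + 1) * face_weight (?dim G)) = - real (?dim F + 1)"
    if F: "F \<in> Field r" for F
  proof -
    obtain L U where LU: "L \<subseteq> U" "F = cube_face L U"
      using F by (auto simp: poset cube_faces_def)
    then have "{G. (G, F) \<in> r} = {G. G \<in> cube_faces \<and> G \<subseteq> cube_face L U}"
      by (auto simp: r cube_faces_def)
    moreover have "?dim F = card (U - L)"
      using LU by (simp add: varying_coordinates_cube_face)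
    ultimately show ?thesis
      using sum_subfaces[OF LU(1), of "\<lambda>i. real (?dim F - i + 1) * face_weight i"]
        face_weight_recurrence[of "card (U - L)"]
      by simp
  qed
  have "G \<subseteq> cube_face {} (UNIV :: 'n set)" if G: "G \<in> cube_faces" for G
  proof -
    obtain L U where LU: "L \<subseteq> U" "G = cube_face L U"
      using G by (auto simp: cube_faces_def)
    show ?thesis
      unfolding LU(2) cube_face_subset_iff[OF LU(1)] by simp
  qed
  then have "{G. G \<in> cube_faces \<and> G \<subseteq> cube_face {} UNIV} = Field r"
    unfolding poset(1) by blast
  then have total: "(\<Sum>F\<in>Field r. face_weight (?dim F)) =
      (\<Sum>i\<le>n. real (n choose i) * 2 ^ (n - i) * face_weight i)"
    using sum_subfaces[of "{}" "UNIV :: 'n set" face_weight] assms(2) by simp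
  have "real_of_int (moebius_number (Rees (cubical_lattice :: (real ^ 'n) set rel) (chain_poset (n + 1)))) =
      - (1 + (\<Sum>F\<in>Field r. face_weight (?dim F)))"
    unfolding Rees_def r_def[symmetric]
    by (rule moebius_number_rees_product_chain[OF poset(2-4) dim rec])
  also have "\<dots> = real_of_int ((- 1) ^ n * composition_sum n)"
    unfolding total face_weight_total[OF assms(1)] by simp
  finally show ?thesis
    unfolding of_int_eq_iff composition_sum_def .
qed

end
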